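(* Let $\alpha \in \{0,1\} \cup [2,\infty)$ and let $M = (C^{(\alpha)},3) \in \mathcal{B}(\ell^2)$ be the generalized Cesàro matrix of order three, i.e. the operator on $\ell^2$ given by the lower triangular infinite matrix $[m_{ij}]_{i,j \geq 0}$ with \[ m_{ij} = \begin{cases} \dfrac{3(i+1-j)(i+2-j)}{(i+1+\alpha)(i+2+\alpha)(i+3+\alpha)} & \text{for } 0 \leq j \leq i, \\ 0 & \text{for } j > i. \end{cases} \] Then $M$ is hyponormal.
   Context: $\ell^2$ is the Hilbert space of square-summable sequences indexed by $n = 0,1,2,\dots$, and infinite matrices act on it with respect to the standard orthonormal basis, so $(Mf)_i = \sum_{j} m_{ij} f_j$. For a Hilbert space $H$, $\mathcal{B}(H)$ denotes the set of bounded linear operators on $H$. The matrix $M$ defines a bounded operator on $\ell^2$ for all real $\alpha > -1$. An operator $A \in \mathcal{B}(H)$ is hyponormal if $\langle (A^*A - AA^* )f, f\rangle \geq 0$ for all $f \in H$. *)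

theory Defs
  imports "HOL-Analysis.Analysis"
begin

section \<open>Complex Hilbert spaces, bounded operators, hyponormality\<close>

text \<open>The inner product is linear in its first argument.\<close>

class complex_hilbert_space = banach +
  fixes scaleC :: "complex \<Rightarrow> 'a \<Rightarrow> 'a" (infixr \<open>*\<^sub>C\<close> 75)
    and cinner :: "'a \<Rightarrow> 'a \<Rightarrow> complex"
  assumes scaleC_add_right: "c *\<^sub>C (x + y) = c *\<^sub>C x + c *\<^sub>C y"
    and scaleC_add_left: "(c + d) *\<^sub>C x = c *\<^sub>C x + d *\<^sub>C x"
    and scaleC_scaleC: "c *\<^sub>C d *\<^sub>C x = (c * d) *\<^sub>C x"
    and scaleR_scaleC: "r *\<^sub>R x = complex_of_real r *\<^sub>C x"
    and cinner_commute: "cinner x y = cnj (cinner y x)"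
    and cinner_add_left: "cinner (x + y) z = cinner x z + cinner y z"
    and cinner_scaleC_left: "cinner (c *\<^sub>C x) y = c * cinner x y"
    and cinner_self: "cinner x x = complex_of_real ((norm x)\<^sup>2)"

definition bounded_operators :: "('a::complex_hilbert_space \<Rightarrow> 'a) set" where
  "bounded_operators =
     {A. bounded_linear A \<and> (\<forall>c f. A (c *\<^sub>C f) = c *\<^sub>C A f)}"

text \<open>For \<open>A\<close> in \<^const>\<open>bounded_operators\<close> the adjoint exists and is unique, by the Riesz representation
  theorem.\<close>

definition cadjoint :: "('a::complex_hilbert_space \<Rightarrow> 'a) \<Rightarrow> 'a \<Rightarrow> 'a" where
  "cadjoint A = (THE B. B \<in> bounded_operators \<and> (\<forall>f g. cinner (A f) g = cinner f (B g)))"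

definition hyponormal :: "('a::complex_hilbert_space \<Rightarrow> 'a) \<Rightarrow> bool" where
  "hyponormal A \<longleftrightarrow> A \<in> bounded_operators \<and>
     (\<forall>f. cinner (cadjoint A (A f) - A (cadjoint A f)) f \<in> \<real>\<^sub>\<ge>\<^sub>0)"


section \<open>The Hilbert space of square-summable sequences\<close>

typedef ell2 = "{f :: nat \<Rightarrow> complex. summable (\<lambda>n. (cmod (f n))\<^sup>2)}"
  morphisms ell2_nth Abs_ell2
  by (rule exI[of _ "\<lambda>_. 0"]) simp

setup_lifting type_definition_ell2

lemma square_add_bound: "(cmod (a + b))\<^sup>2 \<le> 2 * (cmod a)\<^sup>2 + 2 * (cmod b)\<^sup>2"
proof -
  have "(cmod (a + b))\<^sup>2 \<le> (cmod a + cmod b)\<^sup>2"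
    by (intro power_mono norm_triangle_ineq) auto
  also have "\<dots> \<le> 2 * (cmod a)\<^sup>2 + 2 * (cmod b)\<^sup>2"
    using zero_le_power2[of "cmod a - cmod b"] by (simp add: power2_eq_square algebra_simps)
  finally show ?thesis .
qed

lemma square_summable_add:
  assumes "summable (\<lambda>n. (cmod (f n))\<^sup>2)" "summable (\<lambda>n. (cmod (g n))\<^sup>2)"
  shows "summable (\<lambda>n. (cmod (f n + g n))\<^sup>2)"
proof (rule summable_comparison_test')
  show "summable (\<lambda>n. 2 * (cmod (f n))\<^sup>2 + 2 * (cmod (g n))\<^sup>2)"
    by (intro summable_add summable_mult assms)
  show "norm ((cmod (f n + g n))\<^sup>2) \<le> 2 * (cmod (f n))\<^sup>2 + 2 * (cmod (g n))\<^sup>2" for n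
    using square_add_bound[of "f n" "g n"] by simp
qed

lemma square_summable_scale:
  assumes "summable (\<lambda>n. (cmod (f n))\<^sup>2)"
  shows "summable (\<lambda>n. (cmod (c * f n))\<^sup>2)"
  using summable_mult[OF assms, of "(cmod c)\<^sup>2"] by (simp add: norm_mult power_mult_distrib)

lemma square_summable_diff:
  assumes "summable (\<lambda>n. (cmod (f n))\<^sup>2)" "summable (\<lambda>n. (cmod (g n))\<^sup>2)"
  shows "summable (\<lambda>n. (cmod (f n - g n))\<^sup>2)"
  using square_summable_add[OF assms(1) square_summable_scale[OF assms(2), of "-1"]] by simp

lemma square_summable_prod:
  assumes "summable (\<lambda>n. (cmod (f n))\<^sup>2)" "summable (\<lambda>n. (cmod (g n))\<^sup>2)"
  shows "summable (\<lambda>n. f n * cnj (g n))"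
proof (rule summable_comparison_test')
  show "summable (\<lambda>n. (cmod (f n))\<^sup>2 + (cmod (g n))\<^sup>2)"
    by (intro summable_add assms)
  fix n
  have "2 * (cmod (f n) * cmod (g n)) \<le> (cmod (f n))\<^sup>2 + (cmod (g n))\<^sup>2"
    using zero_le_power2[of "cmod (f n) - cmod (g n)"] by (simp add: power2_eq_square algebra_simps)
  moreover have "0 \<le> cmod (f n) * cmod (g n)" by simp
  ultimately have "cmod (f n) * cmod (g n) \<le> (cmod (f n))\<^sup>2 + (cmod (g n))\<^sup>2" by linarith
  then show "norm (f n * cnj (g n)) \<le> (cmod (f n))\<^sup>2 + (cmod (g n))\<^sup>2"
    by (simp add: norm_mult)
qed

instantiation ell2 :: real_normed_vector
begin

lift_definition zero_ell2 :: ell2 is "\<lambda>_. 0" by simp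
lift_definition plus_ell2 :: "ell2 \<Rightarrow> ell2 \<Rightarrow> ell2" is "\<lambda>f g n. f n + g n"
  by (rule square_summable_add)
lift_definition minus_ell2 :: "ell2 \<Rightarrow> ell2 \<Rightarrow> ell2" is "\<lambda>f g n. f n - g n"
  by (rule square_summable_diff)
lift_definition uminus_ell2 :: "ell2 \<Rightarrow> ell2" is "\<lambda>f n. - f n" by simp
lift_definition scaleR_ell2 :: "real \<Rightarrow> ell2 \<Rightarrow> ell2" is "\<lambda>r f n. complex_of_real r * f n"
  by (rule square_summable_scale)
lift_definition norm_ell2 :: "ell2 \<Rightarrow> real" is "\<lambda>f. sqrt (\<Sum>n. (cmod (f n))\<^sup>2)" .

definition dist_ell2 :: "ell2 \<Rightarrow> ell2 \<Rightarrow> real" where "dist_ell2 f g = norm (f - g)"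
definition sgn_ell2 :: "ell2 \<Rightarrow> ell2" where "sgn_ell2 f = inverse (norm f) *\<^sub>R f"
definition uniformity_ell2 :: "(ell2 \<times> ell2) filter" where
  "uniformity_ell2 = (INF e\<in>{0<..}. principal {(x, y). dist x y < e})"
definition open_ell2 :: "ell2 set \<Rightarrow> bool" where
  "open_ell2 U = (\<forall>x\<in>U. \<forall>\<^sub>F (x', y) in uniformity. x' = x \<longrightarrow> y \<in> U)"

instance
proof
  fix f g h :: ell2 and r s :: real
  show "f + g + h = f + (g + h)" by transfer (simp add: add.assoc)
  show "f + g = g + f" by transfer (simp add: add.commute)
  show "0 + f = f" by transfer simp
  show "- f + f = 0" by transfer simp
  show "f - g = f + - g" by transfer simp
  show "r *\<^sub>R (f + g) = r *\<^sub>R f + r *\<^sub>R g" by transfer (simp add: algebra_simps)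
  show "(r + s) *\<^sub>R f = r *\<^sub>R f + s *\<^sub>R f" by transfer (simp add: algebra_simps)
  show "r *\<^sub>R s *\<^sub>R f = (r * s) *\<^sub>R f" by transfer (simp add: algebra_simps)
  show "1 *\<^sub>R f = f" by transfer simp
  show "dist f g = norm (f - g)" by (rule dist_ell2_def)
  show "sgn f = inverse (norm f) *\<^sub>R f" by (rule sgn_ell2_def)
  show "uniformity = (INF e\<in>{0<..}. principal {(x, y :: ell2). dist x y < e})"
    by (rule uniformity_ell2_def)
  show "open U = (\<forall>x\<in>U. \<forall>\<^sub>F (x', y) in uniformity. x' = x \<longrightarrow> y \<in> U)" for U :: "ell2 set"
    by (rule open_ell2_def)
  show "norm f = 0 \<longleftrightarrow> f = 0"
  proof transfer
    fix f :: "nat \<Rightarrow> complex" assume "summable (\<lambda>n. (cmod (f n))\<^sup>2)"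
    then have "(\<Sum>n. (cmod (f n))\<^sup>2) = 0 \<longleftrightarrow> (\<forall>n. (cmod (f n))\<^sup>2 = 0)"
      by (rule suminf_eq_zero_iff) simp
    then show "sqrt (\<Sum>n. (cmod (f n))\<^sup>2) = 0 \<longleftrightarrow> f = (\<lambda>_. 0)"
      by (auto simp: fun_eq_iff)
  qed
  show "norm (r *\<^sub>R f) = \<bar>r\<bar> * norm f"
    by transfer (simp add: norm_mult power_mult_distrib suminf_mult real_sqrt_mult)
  show "norm (f + g) \<le> norm f + norm g"
  proof transfer
    fix f g :: "nat \<Rightarrow> complex"
    assume f: "summable (\<lambda>n. (cmod (f n))\<^sup>2)" and g: "summable (\<lambda>n. (cmod (g n))\<^sup>2)"
    let ?F = "sqrt (\<Sum>n. (cmod (f n))\<^sup>2)" and ?G = "sqrt (\<Sum>n. (cmod (g n))\<^sup>2)"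
    have part: "L2_set (\<lambda>n. cmod (u n)) {..<N} \<le> sqrt (\<Sum>n. (cmod (u n))\<^sup>2)"
      if "summable (\<lambda>n. (cmod (u n))\<^sup>2)" for u :: "nat \<Rightarrow> complex" and N
      unfolding L2_set_def by (intro real_sqrt_le_mono sum_le_suminf that) auto
    have le: "(\<Sum>n<N. (cmod (f n + g n))\<^sup>2) \<le> (?F + ?G)\<^sup>2" for N
    proof -
      have "L2_set (\<lambda>n. cmod (f n + g n)) {..<N} \<le> L2_set (\<lambda>n. cmod (f n) + cmod (g n)) {..<N}"
        by (rule L2_set_mono) (auto intro: norm_triangle_ineq)
      also have "\<dots> \<le> L2_set (\<lambda>n. cmod (f n)) {..<N} + L2_set (\<lambda>n. cmod (g n)) {..<N}"
        by (rule L2_set_triangle_ineq)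
      also have "\<dots> \<le> ?F + ?G" by (intro add_mono part f g)
      finally have "(L2_set (\<lambda>n. cmod (f n + g n)) {..<N})\<^sup>2 \<le> (?F + ?G)\<^sup>2"
        by (intro power_mono L2_set_nonneg)
      then show ?thesis by (simp add: L2_set_def sum_nonneg)
    qed
    have "(\<Sum>n. (cmod (f n + g n))\<^sup>2) \<le> (?F + ?G)\<^sup>2"
      by (intro suminf_le_const square_summable_add f g le)
    moreover have "0 \<le> ?F + ?G" by (simp add: suminf_nonneg f g)
    ultimately show "sqrt (\<Sum>n. (cmod (f n + g n))\<^sup>2) \<le> ?F + ?G"
      by (rule real_le_lsqrt[OF _ , rotated])
  qed
qed

end

lemma ell2_nth_summable: "summable (\<lambda>n. (cmod (ell2_nth f n))\<^sup>2)"
  using ell2_nth[of f] by simp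

lemma ell2_norm_le:
  assumes "\<And>N. (\<Sum>n<N. (cmod (ell2_nth f n))\<^sup>2) \<le> e\<^sup>2" "0 \<le> e"
  shows "norm f \<le> e"
  unfolding norm_ell2.rep_eq
  using suminf_le_const[OF ell2_nth_summable assms(1)] assms(2)
  by (simp add: real_le_lsqrt)

lemma ell2_partial_le: "(\<Sum>n<N. (cmod (ell2_nth f n))\<^sup>2) \<le> (norm f)\<^sup>2"
proof -
  have "0 \<le> (\<Sum>n. (cmod (ell2_nth f n))\<^sup>2)" by (intro suminf_nonneg ell2_nth_summable) auto
  moreover have "(\<Sum>n<N. (cmod (ell2_nth f n))\<^sup>2) \<le> (\<Sum>n. (cmod (ell2_nth f n))\<^sup>2)"
    by (intro sum_le_suminf ell2_nth_summable) auto
  ultimately show ?thesis by (simp add: norm_ell2.rep_eq)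
qed

lemma ell2_coord_le: "cmod (ell2_nth f n) \<le> norm f"
proof -
  have "(cmod (ell2_nth f n))\<^sup>2 \<le> (\<Sum>k<Suc n. (cmod (ell2_nth f k))\<^sup>2)"
    by (simp add: sum_nonneg)
  also have "\<dots> \<le> (norm f)\<^sup>2" by (rule ell2_partial_le)
  finally show ?thesis by (rule power2_le_imp_le) simp
qed

instance ell2 :: banach
proof
  fix X :: "nat \<Rightarrow> ell2"
  assume X: "Cauchy X"
  have "Cauchy (\<lambda>m. ell2_nth (X m) n)" for n
  proof (rule metric_CauchyI)
    fix e :: real assume "0 < e"
    then obtain K where K: "\<forall>m\<ge>K. \<forall>k\<ge>K. dist (X m) (X k) < e"
      using metric_CauchyD[OF X] by blast
    have "dist (ell2_nth (X m) n) (ell2_nth (X k) n) < e" if "m \<ge> K" "k \<ge> K" for m k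
      using K that ell2_coord_le[of "X m - X k" n]
      by (fastforce simp: dist_norm minus_ell2.rep_eq)
    then show "\<exists>K. \<forall>m\<ge>K. \<forall>k\<ge>K. dist (ell2_nth (X m) n) (ell2_nth (X k) n) < e" by blast
  qed
  then have "\<forall>n. \<exists>l. (\<lambda>m. ell2_nth (X m) n) \<longlonglongrightarrow> l"
    by (auto simp: Cauchy_convergent_iff convergent_def)
  then obtain l where l: "\<And>n. (\<lambda>m. ell2_nth (X m) n) \<longlonglongrightarrow> l n" by metis
  have part: "(\<Sum>n<N. (cmod (ell2_nth (X m) n - l n))\<^sup>2) \<le> e\<^sup>2"
    if "\<forall>k\<ge>K. dist (X m) (X k) < e" for e m K N
  proof (rule LIMSEQ_le_const2)
    show "(\<lambda>k. \<Sum>n<N. (cmod (ell2_nth (X m) n - ell2_nth (X k) n))\<^sup>2)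
        \<longlonglongrightarrow> (\<Sum>n<N. (cmod (ell2_nth (X m) n - l n))\<^sup>2)"
      by (intro tendsto_intros l)
    have "(\<Sum>n<N. (cmod (ell2_nth (X m) n - ell2_nth (X k) n))\<^sup>2) \<le> e\<^sup>2" if "k \<ge> K" for k
    proof -
      have "(\<Sum>n<N. (cmod (ell2_nth (X m - X k) n))\<^sup>2) \<le> (norm (X m - X k))\<^sup>2"
        by (rule ell2_partial_le)
      also have "\<dots> \<le> e\<^sup>2"
        using \<open>\<forall>k\<ge>K. dist (X m) (X k) < e\<close> that
        by (intro power_mono) (auto simp: dist_norm intro: less_imp_le)
      finally show ?thesis by (simp add: minus_ell2.rep_eq)
    qed
    then show "\<exists>N'. \<forall>k\<ge>N'. (\<Sum>n<N. (cmod (ell2_nth (X m) n - ell2_nth (X k) n))\<^sup>2) \<le> e\<^sup>2"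
      by blast
  qed
  obtain K1 where K1: "\<forall>m\<ge>K1. \<forall>k\<ge>K1. dist (X m) (X k) < 1"
    using metric_CauchyD[OF X, of 1] by auto
  have "summable (\<lambda>n. (cmod (ell2_nth (X K1) n - l n))\<^sup>2)"
  proof (rule summableI_nonneg_bounded)
    show "(\<Sum>n<N. (cmod (ell2_nth (X K1) n - l n))\<^sup>2) \<le> 1\<^sup>2" for N
      using K1 by (intro part[of K1]) auto
  qed simp
  from square_summable_diff[OF ell2_nth_summable[of "X K1"] this]
  have "summable (\<lambda>n. (cmod (l n))\<^sup>2)" by simp
  then have L: "ell2_nth (Abs_ell2 l) = l" by (simp add: Abs_ell2_inverse)
  have "X \<longlonglongrightarrow> Abs_ell2 l"
  proof (rule metric_LIMSEQ_I)
    fix e :: real assume e: "0 < e"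
    then obtain K where K: "\<forall>m\<ge>K. \<forall>k\<ge>K. dist (X m) (X k) < e/2"
      using metric_CauchyD[OF X, of "e/2"] by auto
    have "dist (X m) (Abs_ell2 l) < e" if "m \<ge> K" for m
    proof -
      have "norm (X m - Abs_ell2 l) \<le> e/2"
        using part[of K m "e/2"] K that e
        by (intro ell2_norm_le) (auto simp: minus_ell2.rep_eq L)
      then show ?thesis using e by (simp add: dist_norm)
    qed
    then show "\<exists>K. \<forall>m\<ge>K. dist (X m) (Abs_ell2 l) < e" by blast
  qed
  then show "convergent X" by (auto simp: convergent_def)
qed

instantiation ell2 :: complex_hilbert_space
begin

lift_definition scaleC_ell2 :: "complex \<Rightarrow> ell2 \<Rightarrow> ell2" is "\<lambda>c f n. c * f n"
  by (rule square_summable_scale)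
lift_definition cinner_ell2 :: "ell2 \<Rightarrow> ell2 \<Rightarrow> complex" is "\<lambda>f g. \<Sum>n. f n * cnj (g n)" .

instance
proof
  fix f g h :: ell2 and c d :: complex and r :: real
  show "c *\<^sub>C (f + g) = c *\<^sub>C f + c *\<^sub>C g" by transfer (simp add: algebra_simps)
  show "(c + d) *\<^sub>C f = c *\<^sub>C f + d *\<^sub>C f" by transfer (simp add: algebra_simps)
  show "c *\<^sub>C d *\<^sub>C f = (c * d) *\<^sub>C f" by transfer (simp add: algebra_simps)
  show "r *\<^sub>R f = complex_of_real r *\<^sub>C f" by transfer simp
  show "cinner f g = cnj (cinner g f)"
  proof transfer
    fix f g :: "nat \<Rightarrow> complex"
    assume "summable (\<lambda>n. (cmod (f n))\<^sup>2)" "summable (\<lambda>n. (cmod (g n))\<^sup>2)"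
    then have "(\<lambda>n. g n * cnj (f n)) sums (\<Sum>n. g n * cnj (f n))"
      by (intro summable_sums square_summable_prod)
    then have "(\<lambda>n. cnj (g n * cnj (f n))) sums cnj (\<Sum>n. g n * cnj (f n))"
      by (simp only: sums_cnj)
    then show "(\<Sum>n. f n * cnj (g n)) = cnj (\<Sum>n. g n * cnj (f n))"
      by (simp add: sums_iff mult.commute)
  qed
  show "cinner (f + g) h = cinner f h + cinner g h"
    by transfer (simp add: distrib_right suminf_add square_summable_prod)
  show "cinner (c *\<^sub>C f) g = c * cinner f g"
    by transfer (simp add: mult.assoc suminf_mult square_summable_prod)
  show "cinner f f = complex_of_real ((norm f)\<^sup>2)"
    by transfer (simp add: complex_norm_square[symmetric] suminf_of_real suminf_nonneg
        del: of_real_power)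
qed

end


section \<open>Infinite matrices and the Cesaro matrix of order three\<close>

text \<open>
  Only meaningful for matrices whose action maps square-summable sequences to square-summable
  sequences; for the matrices considered here this is \<open>ell2_nth_cesaro3\<close> below.
\<close>

definition matrix_operator :: "(nat \<Rightarrow> nat \<Rightarrow> complex) \<Rightarrow> ell2 \<Rightarrow> ell2" where
  "matrix_operator m f = Abs_ell2 (\<lambda>i. \<Sum>j. m i j * ell2_nth f j)"

definition cesaro3 :: "real \<Rightarrow> nat \<Rightarrow> nat \<Rightarrow> real" where
  "cesaro3 \<alpha> i j =
     (if j \<le> i
      then 3 * (real i + 1 - real j) * (real i + 2 - real j)
             / ((real i + 1 + \<alpha>) * (real i + 2 + \<alpha>) * (real i + 3 + \<alpha>))
      else 0)"

abbreviation cesaro3_operator :: "real \<Rightarrow> ell2 \<Rightarrow> ell2" where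
  "cesaro3_operator \<alpha> \<equiv> matrix_operator (\<lambda>i j. complex_of_real (cesaro3 \<alpha> i j))"

lemma hardy_step:
  fixes S a :: real
  assumes "N \<noteq> 0"
  defines "b \<equiv> (S + a) / real (Suc N)"
  shows "b\<^sup>2 - 2 * a * b + (S + a)\<^sup>2 / real (Suc N) \<le> S\<^sup>2 / real N"
proof -
  define c where "c = S / real N"
  have S: "S = real N * c" and T: "S + a = (real N + 1) * b"
    using assms by (simp_all add: b_def c_def add.commute)
  have a: "a = (real N + 1) * b - real N * c" using S T by simp
  have "b\<^sup>2 - 2 * a * b + (real N + 1) * b\<^sup>2 = real N * c\<^sup>2 - real N * (b - c)\<^sup>2"
    unfolding a by (simp add: power2_eq_square algebra_simps)
  also have "\<dots> \<le> real N * c\<^sup>2" by simp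
  finally have "b\<^sup>2 - 2 * a * b + (real N + 1) * b\<^sup>2 \<le> real N * c\<^sup>2" .
  moreover have "(S + a)\<^sup>2 / real (Suc N) = (real N + 1) * b\<^sup>2"
    by (simp add: b_def power2_eq_square add.commute)
  moreover have "S\<^sup>2 / real N = real N * c\<^sup>2" using assms by (simp add: c_def power2_eq_square)
  ultimately show ?thesis by simp
qed

lemma hardy_inequality:
  fixes a :: "nat \<Rightarrow> real"
  defines "b \<equiv> \<lambda>i. (\<Sum>j\<le>i. a j) / real (Suc i)"
  shows "(\<Sum>i<N. (b i)\<^sup>2) \<le> 4 * (\<Sum>i<N. (a i)\<^sup>2)"
proof -
  have "(\<Sum>i<N. (b i)\<^sup>2 - 2 * a i * b i) + (\<Sum>j<N. a j)\<^sup>2 / real N \<le> 0"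
  proof (induction N)
    case (Suc N)
    have b: "b N = ((\<Sum>j<N. a j) + a N) / real (Suc N)"
      by (simp add: b_def lessThan_Suc_atMost[symmetric])
    show ?case
    proof (cases "N = 0")
      case True
      then show ?thesis using b by (simp add: power2_eq_square)
    next
      case False
      then show ?thesis
        using Suc.IH hardy_step[of N "\<Sum>j<N. a j" "a N"] b by simp
    qed
  qed simp
  moreover have "0 \<le> (\<Sum>j<N. a j)\<^sup>2 / real N" by simp
  ultimately have "(\<Sum>i<N. (b i)\<^sup>2 - 2 * a i * b i) \<le> 0" by linarith
  moreover have "(\<Sum>i<N. (b i)\<^sup>2 / 2 - 2 * (a i)\<^sup>2) \<le> (\<Sum>i<N. (b i)\<^sup>2 - 2 * a i * b i)"
  proof (rule sum_mono)
    fix i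
    show "(b i)\<^sup>2 / 2 - 2 * (a i)\<^sup>2 \<le> (b i)\<^sup>2 - 2 * a i * b i"
      using zero_le_power2[of "b i - 2 * a i"] by (simp add: power2_eq_square algebra_simps)
  qed
  ultimately show ?thesis
    by (simp add: sum_subtractf sum_distrib_left[symmetric] sum_divide_distrib[symmetric])
qed

lemma cesaro3_bound:
  assumes "0 \<le> \<alpha>"
  shows "\<bar>cesaro3 \<alpha> i j\<bar> \<le> 3 / real (Suc i)"
proof (cases "j \<le> i")
  case True
  let ?x = "real i + 1 - real j" and ?y = "real i + 2 - real j"
  let ?p = "real i + 1 + \<alpha>" and ?q = "real i + 2 + \<alpha>" and ?r = "real i + 3 + \<alpha>"
  have "?x * ?y \<le> ?q * ?r" using True assms by (intro mult_mono) auto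
  moreover have pos: "0 < ?q * ?r" "0 < ?p" using assms by auto
  ultimately have "?x * ?y / (?q * ?r) \<le> 1" by simp
  moreover have "3 / ?p \<le> 3 / real (Suc i)" using assms by (intro divide_left_mono) auto
  moreover have "0 \<le> ?x * ?y / (?q * ?r)" using True assms by simp
  ultimately have "3 / ?p * (?x * ?y / (?q * ?r)) \<le> 3 / real (Suc i) * 1"
    using pos by (intro mult_mono) auto
  moreover have "cesaro3 \<alpha> i j = 3 / ?p * (?x * ?y / (?q * ?r))"
    using True by (simp add: cesaro3_def mult.assoc)
  moreover have "0 \<le> 3 / ?p * (?x * ?y / (?q * ?r))"
    using True assms by simp
  ultimately show ?thesis by linarith
qed (simp add: cesaro3_def)

lemma cesaro3_row:
  "(\<Sum>j. complex_of_real (cesaro3 \<alpha> i j) * f j) = (\<Sum>j\<le>i. complex_of_real (cesaro3 \<alpha> i j) * f j)"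
  by (rule suminf_finite) (auto simp: cesaro3_def)

lemma cesaro3_partial:
  assumes "0 \<le> \<alpha>"
  shows "(\<Sum>i<N. (cmod (\<Sum>j\<le>i. complex_of_real (cesaro3 \<alpha> i j) * ell2_nth f j))\<^sup>2) \<le> (6 * norm f)\<^sup>2"
proof -
  define b where "b i = (\<Sum>j\<le>i. cmod (ell2_nth f j)) / real (Suc i)" for i
  have "cmod (\<Sum>j\<le>i. complex_of_real (cesaro3 \<alpha> i j) * ell2_nth f j) \<le> 3 * b i" for i
  proof -
    have "cmod (\<Sum>j\<le>i. complex_of_real (cesaro3 \<alpha> i j) * ell2_nth f j)
        \<le> (\<Sum>j\<le>i. 3 / real (Suc i) * cmod (ell2_nth f j))"
    proof (intro sum_norm_le)
      show "cmod (complex_of_real (cesaro3 \<alpha> i j) * ell2_nth f j) \<le> 3 / real (Suc i) * cmod (ell2_nth f j)" for j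
        unfolding norm_mult norm_of_real by (intro mult_right_mono cesaro3_bound assms norm_ge_zero)
    qed
    also have "\<dots> = 3 * b i" unfolding b_def sum_distrib_left[symmetric] by simp
    finally show ?thesis .
  qed
  then have "(\<Sum>i<N. (cmod (\<Sum>j\<le>i. complex_of_real (cesaro3 \<alpha> i j) * ell2_nth f j))\<^sup>2)
      \<le> (\<Sum>i<N. (3 * b i)\<^sup>2)"
    by (intro sum_mono power_mono) auto
  also have "\<dots> = 9 * (\<Sum>i<N. (b i)\<^sup>2)" by (simp add: power_mult_distrib sum_distrib_left)
  also have "\<dots> \<le> 9 * (4 * (\<Sum>i<N. (cmod (ell2_nth f i))\<^sup>2))"
    unfolding b_def by (intro mult_left_mono hardy_inequality) simp
  also have "\<dots> \<le> 9 * (4 * (norm f)\<^sup>2)" using ell2_partial_le[where f = f and N = N] by simp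
  also have "\<dots> = (6 * norm f)\<^sup>2" by (simp add: power_mult_distrib)
  finally show ?thesis .
qed

lemma ell2_nth_cesaro3:
  assumes "0 \<le> \<alpha>"
  shows "ell2_nth (cesaro3_operator \<alpha> f) i
    = (\<Sum>j\<le>i. complex_of_real (cesaro3 \<alpha> i j) * ell2_nth f j)"
proof -
  have "summable (\<lambda>i. (cmod (\<Sum>j\<le>i. complex_of_real (cesaro3 \<alpha> i j) * ell2_nth f j))\<^sup>2)"
    by (rule summableI_nonneg_bounded[OF _ cesaro3_partial[OF assms]]) simp
  then show ?thesis by (simp add: matrix_operator_def cesaro3_row Abs_ell2_inverse)
qed

lemma cesaro3_bounded:
  assumes "0 \<le> \<alpha>"
  shows "cesaro3_operator \<alpha> \<in> bounded_operators"
proof -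
  let ?M = "cesaro3_operator \<alpha>"
  note nth = ell2_nth_cesaro3[OF assms]
  have ext: "f = g" if "\<And>i. ell2_nth f i = ell2_nth g i" for f g
    using that by (auto simp: ell2_nth_inject[symmetric])
  have scale: "?M (c *\<^sub>C f) = c *\<^sub>C ?M f" for c f
    by (rule ext) (simp add: nth scaleC_ell2.rep_eq sum_distrib_left algebra_simps)
  have "bounded_linear ?M"
  proof (rule bounded_linear_intro[where K = 6])
    show "?M (f + g) = ?M f + ?M g" for f g
      by (rule ext) (simp add: nth plus_ell2.rep_eq distrib_left sum.distrib)
    show "?M (r *\<^sub>R f) = r *\<^sub>R ?M f" for r f
      by (simp add: scaleR_scaleC scale)
    show "norm (?M f) \<le> norm f * 6" for f
      using ell2_norm_le[of "?M f" "6 * norm f"] cesaro3_partial[OF assms]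
      by (simp add: nth mult.commute)
  qed
  with scale show ?thesis by (simp add: bounded_operators_def)
qed

end

theory Submission
  imports Defs
begin

text \<open>
  Write \<open>M = 6 D T\<close> with \<open>T = (I - S)\<^sup>-\<^sup>3\<close>, \<open>S\<close> the unilateral shift and \<open>D\<close> diagonal with entries
  \<open>d(n + \<alpha>)\<close>, where \<open>d(\<mu>) = 1 / ((\<mu> + 1) (\<mu> + 2) (\<mu> + 3))\<close>. It suffices to show that \<open>M\<^sup>*\<close> is dominated in
  norm by \<open>M\<close> on the dense set of all \<open>f = (I - S)\<^sup>3 u\<close> with \<open>u\<close> finitely supported. For such \<open>f\<close>,
  \<open>M f = 6 D u\<close>, and \<open>M\<^sup>* f = 6 y\<close> where the \<open>n\<close>-th term of \<open>u\<close> contributes to \<open>y\<^sub>j\<close> the value of a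
  quadratic polynomial \<open>\<kappa>\<^sub>n(j + \<alpha>)\<close> if \<open>j \<le> n + 2\<close>, the number \<open>- d(n + 3 + \<alpha>)\<close> if \<open>j = n + 3\<close>, and
  nothing beyond.

  Let \<open>\<Psi>\<^sub>X(q)\<close> be the polynomial in \<open>X\<close> that equals \<open>\<Sum>z<X. q(z)\<^sup>2\<close> for natural \<open>X\<close>, for quadratic
  polynomials \<open>q\<close>. At \<open>X = n + 3 + \<alpha>\<close> the polynomial \<open>\<kappa>\<^sub>n\<close> represents evaluation at \<open>X\<close>, up to the
  factor \<open>d(X)\<close>, for the bilinear form of \<open>\<Psi>\<^sub>X\<close>. Hence the energies of the tails
  \<open>Q\<^sub>n = \<Sum>m\<ge>n. u\<^sub>m \<kappa>\<^sub>m\<close> telescope, with the outcome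
  \<open>\<parallel>y\<parallel>\<^sup>2 + \<Psi>\<^sub>\<alpha>(Q\<^sub>0) = \<Sum>n. d(n + \<alpha>) d(n + 3 + \<alpha>) u\<^sub>n\<^sup>2 \<le> \<parallel>D u\<parallel>\<^sup>2\<close>.
  The form \<open>\<Psi>\<^sub>\<alpha>\<close> is positive semidefinite if \<open>\<alpha> \<in> {0, 1} \<union> [2, \<infinity>)\<close>.
\<close>


section \<open>The energy of quadratic polynomials\<close>

definition cesaro_weight :: "real \<Rightarrow> real" where
  "cesaro_weight \<mu> = 1 / ((\<mu> + 1) * (\<mu> + 2) * (\<mu> + 3))"

definition third_difference :: "(real \<Rightarrow> real) \<Rightarrow> real \<Rightarrow> real" where
  "third_difference F \<mu> = F \<mu> - 3 * F (\<mu> + 1) + 3 * F (\<mu> + 2) - F (\<mu> + 3)"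

text \<open>The coefficients of the polynomial \<open>\<kappa>\<^sub>n\<close>, for \<open>\<mu> = n + \<alpha>\<close>.\<close>

definition kernel_coeff0 :: "real \<Rightarrow> real" where
  "kernel_coeff0 \<mu> = third_difference (\<lambda>m. cesaro_weight m * ((m + 1) * (m + 2) / 2)) \<mu>"
definition kernel_coeff1 :: "real \<Rightarrow> real" where
  "kernel_coeff1 \<mu> = third_difference (\<lambda>m. cesaro_weight m * (- (2 * m + 3) / 2)) \<mu>"
definition kernel_coeff2 :: "real \<Rightarrow> real" where
  "kernel_coeff2 \<mu> = third_difference (\<lambda>m. cesaro_weight m * (1 / 2)) \<mu>"

text \<open>The value \<open>power_sum\<^sub>k X\<close> is \<open>\<Sum>z<X. z\<^sup>k\<close> for natural \<open>X\<close>.\<close>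

definition power_sum1 :: "real \<Rightarrow> real" where "power_sum1 X = X * (X - 1) / 2"
definition power_sum2 :: "real \<Rightarrow> real" where "power_sum2 X = X * (X - 1) * (2 * X - 1) / 6"
definition power_sum3 :: "real \<Rightarrow> real" where "power_sum3 X = X\<^sup>2 * (X - 1)\<^sup>2 / 4"
definition power_sum4 :: "real \<Rightarrow> real" where
  "power_sum4 X = X * (X - 1) * (2 * X - 1) * (3 * X\<^sup>2 - 3 * X - 1) / 30"

definition quadratic_energy :: "real \<Rightarrow> real \<Rightarrow> real \<Rightarrow> real \<Rightarrow> real" where
  "quadratic_energy X a b c = a\<^sup>2 * X + 2 * a * b * power_sum1 X + (2 * a * c + b\<^sup>2) * power_sum2 X
     + 2 * b * c * power_sum3 X + c\<^sup>2 * power_sum4 X"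

lemmas power_sum_defs = power_sum1_def power_sum2_def power_sum3_def power_sum4_def

lemma quadratic_energy_Suc:
  "quadratic_energy (X + 1) a b c = quadratic_energy X a b c + (a + b * X + c * X\<^sup>2)\<^sup>2"
  unfolding quadratic_energy_def power_sum_defs by (simp add: field_simps power2_eq_square)

text \<open>Expansion in the discrete Chebyshev polynomials, orthogonal on
  \<open>0, ..., X - 1\<close> for natural \<open>X\<close>; the factors \<open>X\<close>,
  \<open>X (X^2 - 1) / 12\<close> and \<open>X (X^2 - 1) (X^2 - 4) / 180\<close> are the squared
  norms of the monic ones. All three are nonnegative exactly on
  \<open>{0, 1} \<union> {2..}\<close>, the range allowed for \<alpha>.\<close>

lemma quadratic_energy_sos:
  "quadratic_energy X a b c = X * (a + b * (X - 1) / 2 + c * (X - 1) * (2 * X - 1) / 6)\<^sup>2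
     + X * (X - 1) * (X + 1) / 12 * (b + c * (X - 1))\<^sup>2
     + X * (X - 1) * (X + 1) * (X - 2) * (X + 2) / 180 * c\<^sup>2"
  unfolding quadratic_energy_def power_sum_defs by (simp add: field_simps power2_eq_square)

lemma quadratic_energy_nonneg:
  assumes "X \<in> {0, 1} \<union> {2..}"
  shows "0 \<le> quadratic_energy X a b c"
proof -
  have "X = 0 \<or> X = 1 \<or> 2 \<le> X" using assms by auto
  then have "0 \<le> X" "0 \<le> X * (X - 1) * (X + 1)" "0 \<le> X * (X - 1) * (X + 1) * (X - 2) * (X + 2)"
    by auto
  then show ?thesis unfolding quadratic_energy_sos by (intro add_nonneg_nonneg mult_nonneg_nonneg) auto
qed

section \<open>The kernel polynomials and their reproducing property\<close>

lemma kernel_coeff_eq: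
  assumes "0 \<le> \<mu>"
  defines "P \<equiv> (\<mu> + 1) * (\<mu> + 2) * (\<mu> + 3) * (\<mu> + 4) * (\<mu> + 5) * (\<mu> + 6)"
  shows "kernel_coeff0 \<mu> = 3 * (\<mu> + 1) * (\<mu> + 2) / P"
    and "kernel_coeff1 \<mu> = - 6 * (4 * \<mu> + 9) / P"
    and "kernel_coeff2 \<mu> = 30 / P"
    and "cesaro_weight (\<mu> + 3) = (\<mu> + 1) * (\<mu> + 2) * (\<mu> + 3) / P"
  unfolding kernel_coeff0_def kernel_coeff1_def kernel_coeff2_def third_difference_def
    cesaro_weight_def P_def
  using assms(1) by (simp add: divide_simps; algebra)+

text \<open>The bilinear form of \<^const>\<open>quadratic_energy\<close>, applied to the kernel and \<open>1, z, z\<^sup>2\<close>.\<close>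

lemma kernel_reproducing:
  assumes "0 \<le> \<mu>"
  defines "a \<equiv> kernel_coeff0 \<mu>" and "b \<equiv> kernel_coeff1 \<mu>" and "c \<equiv> kernel_coeff2 \<mu>"
    and "X \<equiv> \<mu> + 3"
  shows "a * X + b * power_sum1 X + c * power_sum2 X = cesaro_weight (\<mu> + 3)"
    and "a * power_sum1 X + b * power_sum2 X + c * power_sum3 X = cesaro_weight (\<mu> + 3) * X"
    and "a * power_sum2 X + b * power_sum3 X + c * power_sum4 X = cesaro_weight (\<mu> + 3) * X\<^sup>2"
proof -
  define P where "P = (\<mu> + 1) * (\<mu> + 2) * (\<mu> + 3) * (\<mu> + 4) * (\<mu> + 5) * (\<mu> + 6)"
  note eqs = kernel_coeff_eq[OF assms(1), folded P_def]
  \<comment> \<open>Over the common denominator \<open>P\<close> each claim becomes an identity of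
    polynomials; fact \<open>1\<close> supplies the missing factor in the first one.\<close>
  have eq: "x / P * s + y / P * t + z / P * r = w / P * v" if "x * s + y * t + z * r = w * v"
    for x y z w s t r v
    using that by (simp add: add_divide_distrib[symmetric])
  have 1: "x * s + y * t + z * r = w" if "x * s + y * t + z * r = w * 1" for x y z w s t r :: real
    using that by simp
  show "a * X + b * power_sum1 X + c * power_sum2 X = cesaro_weight (\<mu> + 3)"
    unfolding a_def b_def c_def X_def eqs
    by (rule 1, rule eq) (simp add: power_sum_defs field_simps power2_eq_square)
  show "a * power_sum1 X + b * power_sum2 X + c * power_sum3 X = cesaro_weight (\<mu> + 3) * X"
    unfolding a_def b_def c_def X_def eqs
    by (rule eq) (simp add: power_sum_defs field_simps power2_eq_square)
  show "a * power_sum2 X + b * power_sum3 X + c * power_sum4 X = cesaro_weight (\<mu> + 3) * X\<^sup>2"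
    unfolding a_def b_def c_def X_def eqs
    by (rule eq) (simp add: power_sum_defs field_simps power2_eq_square)
qed

lemma kernel_value:
  "kernel_coeff0 \<mu> + kernel_coeff1 \<mu> * z + kernel_coeff2 \<mu> * z\<^sup>2
     = third_difference (\<lambda>m. cesaro_weight m * ((m - z + 1) * (m - z + 2) / 2)) \<mu>"
  unfolding kernel_coeff0_def kernel_coeff1_def kernel_coeff2_def third_difference_def
  by (simp add: field_simps power2_eq_square)

text \<open>Let \<open>q = a + b z + c z^2\<close>. By the reproducing property, adding
  \<open>u \<kappa>\<close> to \<open>q\<close> changes the energy by
  \<open>2 u d(X) q(X) + u^2 d(X) \<kappa>(X)\<close>, where
  \<open>\<kappa>(X) = d(\<mu>) - d(X)\<close>. The added square cancels the cross term and leaves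
  \<open>q(X)^2\<close>, which raises \<open>X\<close> to \<open>X + 1\<close>.\<close>

lemma quadratic_energy_kernel_step:
  assumes "0 \<le> \<mu>"
  defines "X \<equiv> \<mu> + 3"
  shows "quadratic_energy X (a + u * kernel_coeff0 \<mu>) (b + u * kernel_coeff1 \<mu>) (c + u * kernel_coeff2 \<mu>)
           + (a + b * X + c * X\<^sup>2 - cesaro_weight X * u)\<^sup>2
         = quadratic_energy (X + 1) a b c + cesaro_weight \<mu> * cesaro_weight X * u\<^sup>2"
proof -
  let ?k = "kernel_coeff0 \<mu>" and ?l = "kernel_coeff1 \<mu>" and ?m = "kernel_coeff2 \<mu>"
  let ?w = "cesaro_weight (\<mu> + 3)"
  note rep = kernel_reproducing[OF assms(1), folded X_def]
  \<comment> \<open>At \<open>z = \<mu> + 3\<close> the factor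
    \<open>(m - z + 1) (m - z + 2) / 2\<close> is 1 for \<open>m = \<mu>\<close> and
    \<open>m = \<mu> + 3\<close>, and 0 for the two values between.\<close>
  have at_X: "?k + ?l * X + ?m * X\<^sup>2 = cesaro_weight \<mu> - cesaro_weight X"
    unfolding kernel_value third_difference_def X_def by simp
  have "quadratic_energy X (a + u * ?k) (b + u * ?l) (c + u * ?m)
      = quadratic_energy X a b c
        + 2 * u * (a * (?k * X + ?l * power_sum1 X + ?m * power_sum2 X)
          + b * (?k * power_sum1 X + ?l * power_sum2 X + ?m * power_sum3 X)
          + c * (?k * power_sum2 X + ?l * power_sum3 X + ?m * power_sum4 X))
        + u\<^sup>2 * (?k * (?k * X + ?l * power_sum1 X + ?m * power_sum2 X)
          + ?l * (?k * power_sum1 X + ?l * power_sum2 X + ?m * power_sum3 X)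
          + ?m * (?k * power_sum2 X + ?l * power_sum3 X + ?m * power_sum4 X))"
    unfolding quadratic_energy_def by algebra
  also have "\<dots> = quadratic_energy X a b c + 2 * u * cesaro_weight X * (a + b * X + c * X\<^sup>2)
      + u\<^sup>2 * cesaro_weight X * (?k + ?l * X + ?m * X\<^sup>2)"
    unfolding rep by algebra
  finally show ?thesis
    unfolding quadratic_energy_Suc at_X by algebra
qed

section \<open>The columns of the matrix and the contraction estimate\<close>

definition pairing_weight :: "real \<Rightarrow> nat \<Rightarrow> nat \<Rightarrow> real" where
  "pairing_weight \<alpha> j i = (if j \<le> i
     then cesaro_weight (real i + \<alpha>) * ((real i - real j + 1) * (real i - real j + 2) / 2) else 0)"

text \<open>\<open>pairing_weight \<alpha> j i\<close> is one sixth of the matrix entry in row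
  \<open>i\<close> and column \<open>j\<close>. Differencing three times in the row index gives one
  sixth of coordinate \<open>j\<close> of
  \<open>M\<^sup>* (I - S)\<^sup>3 e\<^sub>n\<close>.\<close>

definition pairing_kernel :: "real \<Rightarrow> nat \<Rightarrow> nat \<Rightarrow> real" where
  "pairing_kernel \<alpha> j n = pairing_weight \<alpha> j n - 3 * pairing_weight \<alpha> j (n + 1)
     + 3 * pairing_weight \<alpha> j (n + 2) - pairing_weight \<alpha> j (n + 3)"

text \<open>The quadratic factor vanishes at \<open>i = j - 1\<close> and \<open>i = j - 2\<close>,
  so the formula survives two places above the diagonal. Hence the kernel is polynomial up to
  \<open>j = n + 2\<close>.\<close>

lemma pairing_weight_eq:
  assumes "j \<le> i + 2"
  shows "pairing_weight \<alpha> j i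
    = cesaro_weight (real i + \<alpha>) * ((real i - real j + 1) * (real i - real j + 2) / 2)"
proof (cases "j \<le> i")
  case False
  with assms have "j = i + 1 \<or> j = i + 2" by auto
  then show ?thesis using False by (auto simp: pairing_weight_def)
qed (simp add: pairing_weight_def)

lemma pairing_kernel_below:
  assumes "j \<le> n + 2"
  shows "pairing_kernel \<alpha> j n = kernel_coeff0 (real n + \<alpha>) + kernel_coeff1 (real n + \<alpha>) * (real j + \<alpha>)
    + kernel_coeff2 (real n + \<alpha>) * (real j + \<alpha>)\<^sup>2"
  unfolding kernel_value pairing_kernel_def third_difference_def
  using assms by (simp add: pairing_weight_eq add_ac)

lemma pairing_kernel_edge:
  "pairing_kernel \<alpha> (n + 3) n = - cesaro_weight (real (n + 3) + \<alpha>)"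
  by (simp add: pairing_kernel_def pairing_weight_def)

lemma pairing_kernel_above: "n + 3 < j \<Longrightarrow> pairing_kernel \<alpha> j n = 0"
  by (simp add: pairing_kernel_def pairing_weight_def)

lemma cesaro_weight_decreasing:
  assumes "0 \<le> \<mu>"
  shows "0 \<le> cesaro_weight \<mu>" "cesaro_weight (\<mu> + 3) \<le> cesaro_weight \<mu>"
  using assms by (auto simp: cesaro_weight_def intro!: divide_left_mono mult_mono)

text \<open>For \<open>u\<close> cut off at \<open>N\<close> and
  \<open>f = (I - S)\<^sup>3 u\<close>, the two sides are the squared norms of
  \<open>M\<^sup>* f\<close> and \<open>M f\<close>, each divided by 36.\<close>

lemma pairing_kernel_contraction:
  fixes u :: "nat \<Rightarrow> real" and N :: nat
  assumes \<alpha>: "\<alpha> \<in> {0, 1} \<union> {2..}"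
  defines "y \<equiv> \<lambda>j. \<Sum>n<N. u n * pairing_kernel \<alpha> j n"
  shows "(\<Sum>j<N + 3. (y j)\<^sup>2) \<le> (\<Sum>n<N. (cesaro_weight (real n + \<alpha>) * u n)\<^sup>2)"
proof -
  have \<alpha>0: "0 \<le> \<alpha>" using \<alpha> by auto
  \<comment> \<open>\<open>a n\<close>, \<open>b n\<close>, \<open>c n\<close> are the coefficients
    of the tail \<open>Q\<^sub>n\<close>.\<close>
  define a where "a n = (\<Sum>m=n..<N. u m * kernel_coeff0 (real m + \<alpha>))" for n
  define b where "b n = (\<Sum>m=n..<N. u m * kernel_coeff1 (real m + \<alpha>))" for n
  define c where "c n = (\<Sum>m=n..<N. u m * kernel_coeff2 (real m + \<alpha>))" for n
  define w where "w n = cesaro_weight (real n + \<alpha>)" for n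
  have tail: "(\<Sum>m=n..<N. u m * pairing_kernel \<alpha> j m)
      = a n + b n * (real j + \<alpha>) + c n * (real j + \<alpha>)\<^sup>2" if "j \<le> n + 2" for n j
  proof -
    have "(\<Sum>m=n..<N. u m * pairing_kernel \<alpha> j m) = (\<Sum>m=n..<N. u m * (kernel_coeff0 (real m + \<alpha>)
        + kernel_coeff1 (real m + \<alpha>) * (real j + \<alpha>) + kernel_coeff2 (real m + \<alpha>) * (real j + \<alpha>)\<^sup>2))"
      using that by (intro sum.cong refl) (simp add: pairing_kernel_below)
    also have "\<dots> = a n + b n * (real j + \<alpha>) + c n * (real j + \<alpha>)\<^sup>2"
      by (simp add: a_def b_def c_def sum_distrib_right distrib_left sum.distrib mult.assoc)
    finally show ?thesis .
  qed
  have low: "y j = a 0 + b 0 * (real j + \<alpha>) + c 0 * (real j + \<alpha>)\<^sup>2" if "j < 3" for j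
    using tail[of j 0] that by (simp add: y_def atLeast0LessThan)
  \<comment> \<open>At \<open>n + 3\<close> the terms \<open>m < n\<close> vanish, the term
    \<open>m = n\<close> is the edge value, and the terms \<open>m > n\<close> are still in the
    polynomial range \<open>j \<le> m + 2\<close>.\<close>
  have high: "y (n + 3) = a (Suc n) + b (Suc n) * (real n + \<alpha> + 3) + c (Suc n) * (real n + \<alpha> + 3)\<^sup>2
      - w (n + 3) * u n" if "n < N" for n
  proof -
    have "y (n + 3) = (\<Sum>m<n. u m * pairing_kernel \<alpha> (n + 3) m)
        + (\<Sum>m=n..<N. u m * pairing_kernel \<alpha> (n + 3) m)"
      using sum.atLeastLessThan_concat[of 0 n N "\<lambda>m. u m * pairing_kernel \<alpha> (n + 3) m"] that
      unfolding y_def by (simp only: atLeast0LessThan)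
    also have "(\<Sum>m<n. u m * pairing_kernel \<alpha> (n + 3) m) = 0"
      by (intro sum.neutral) (simp add: pairing_kernel_above)
    also have "(\<Sum>m=n..<N. u m * pairing_kernel \<alpha> (n + 3) m)
        = u n * pairing_kernel \<alpha> (n + 3) n + (\<Sum>m=Suc n..<N. u m * pairing_kernel \<alpha> (n + 3) m)"
      using that by (simp add: sum.atLeast_Suc_lessThan)
    finally show ?thesis using tail[of "n + 3" "Suc n"]
      by (simp add: pairing_kernel_edge w_def add_ac)
  qed
  \<comment> \<open>The evaluation point moves with \<open>n\<close>, so that the kernel step, with
    \<open>Q\<^sub>n\<^sub>+\<^sub>1\<close> as its polynomial, relates \<open>E n\<close> to
    \<open>E (Suc n)\<close>.\<close>
  define E where "E n = quadratic_energy (real n + \<alpha> + 3) (a n) (b n) (c n)" for n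
  have step: "(y (n + 3))\<^sup>2 - w n * w (n + 3) * (u n)\<^sup>2 = E (Suc n) - E n" if "n < N" for n
  proof -
    have rec: "a n = a (Suc n) + u n * kernel_coeff0 (real n + \<alpha>)"
       "b n = b (Suc n) + u n * kernel_coeff1 (real n + \<alpha>)"
       "c n = c (Suc n) + u n * kernel_coeff2 (real n + \<alpha>)"
      using that by (simp_all add: a_def b_def c_def sum.atLeast_Suc_lessThan)
    have arg: "real (Suc n) + \<alpha> + 3 = real n + \<alpha> + 3 + 1" by simp
    show ?thesis
      using quadratic_energy_kernel_step[of "real n + \<alpha>" "a (Suc n)" "u n" "b (Suc n)" "c (Suc n)"] \<alpha>0
      unfolding high[OF that] E_def rec[symmetric] arg by (simp add: w_def add_ac)
  qed
  have "(\<Sum>n<N. (y (n + 3))\<^sup>2 - w n * w (n + 3) * (u n)\<^sup>2) = (\<Sum>n<N. E (Suc n) - E n)"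
    by (intro sum.cong refl step) auto
  also have "\<dots> = E N - E 0" by (rule sum_lessThan_telescope)
  also have "E N = 0" by (simp add: E_def a_def b_def c_def quadratic_energy_def)
  finally have energy: "(\<Sum>n<N. (y (n + 3))\<^sup>2) + E 0 = (\<Sum>n<N. w n * w (n + 3) * (u n)\<^sup>2)"
    by (simp add: sum_subtractf)
  \<comment> \<open>Peeling off the points \<alpha>, \<alpha> + 1, \<alpha> + 2 yields the three
    values of \<open>y\<close> not covered by the telescoping and leaves the nonnegative energy at
    \<alpha>.\<close>
  have "E 0 = quadratic_energy (\<alpha> + 1 + 1 + 1) (a 0) (b 0) (c 0)" by (simp add: E_def add_ac)
  also have "\<dots> = quadratic_energy \<alpha> (a 0) (b 0) (c 0) + (y 0)\<^sup>2 + (y 1)\<^sup>2 + (y 2)\<^sup>2"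
    unfolding quadratic_energy_Suc by (simp add: low add_ac)
  also have "\<dots> \<ge> (y 0)\<^sup>2 + (y 1)\<^sup>2 + (y 2)\<^sup>2"
    using quadratic_energy_nonneg[OF \<alpha>] by simp
  finally have "(y 0)\<^sup>2 + (y 1)\<^sup>2 + (y 2)\<^sup>2 \<le> E 0" .
  moreover have "(\<Sum>j<N + 3. (y j)\<^sup>2) = (y 0)\<^sup>2 + (y 1)\<^sup>2 + (y 2)\<^sup>2 + (\<Sum>n<N. (y (n + 3))\<^sup>2)"
    by (simp add: numeral_3_eq_3 numeral_2_eq_2 sum.lessThan_Suc_shift del: sum.lessThan_Suc)
  moreover have "(\<Sum>n<N. w n * w (n + 3) * (u n)\<^sup>2) \<le> (\<Sum>n<N. (w n * u n)\<^sup>2)"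
  proof (rule sum_mono)
    fix n
    have "w n * w (n + 3) \<le> w n * w n"
      using cesaro_weight_decreasing[of "real n + \<alpha>"] \<alpha>0
      by (intro mult_left_mono) (simp_all add: w_def add_ac)
    then show "w n * w (n + 3) * (u n)\<^sup>2 \<le> (w n * u n)\<^sup>2"
      unfolding power_mult_distrib power2_eq_square[of "w n"] by (rule mult_right_mono) simp
  qed
  ultimately show ?thesis using energy by (simp add: w_def)
qed


section \<open>Adjoints and hyponormality\<close>

lemma cinner_add_right: "cinner x (y + z) = cinner x y + cinner x z"
  by (metis cinner_add_left cinner_commute complex_cnj_add)

lemma cinner_scaleC_right: "cinner x (c *\<^sub>C y) = cnj c * cinner x y"
  by (metis cinner_commute cinner_scaleC_left complex_cnj_mult)

lemma scaleC_minus1: "(- 1) *\<^sub>C x = - x"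
  using scaleR_scaleC[of "-1" x] by simp

lemma cinner_minus_left: "cinner (- x) y = - cinner x y"
  using cinner_scaleC_left[of "-1" x y] by (simp add: scaleC_minus1)

lemma cinner_diff_left: "cinner (x - y) z = cinner x z - cinner y z"
  using cinner_add_left[of x "- y" z] by (simp add: cinner_minus_left)

lemma cinner_diff_right: "cinner x (y - z) = cinner x y - cinner x z"
  by (metis cinner_commute cinner_diff_left complex_cnj_diff)

lemma cinner_zero_left [simp]: "cinner 0 y = 0"
  using cinner_diff_left[of y y y] by simp

lemma cinner_zero_right [simp]: "cinner x 0 = 0"
  using cinner_diff_right[of x x x] by simp

lemma cinner_sum_right: "cinner x (\<Sum>i\<in>I. y i) = (\<Sum>i\<in>I. cinner x (y i))"
  by (induction I rule: infinite_finite_induct) (simp_all add: cinner_add_right)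

lemma cinner_Cauchy_Schwarz: "cmod (cinner x y) \<le> norm x * norm y"
proof (cases "y = 0")
  case False
  then have y: "norm y > 0" by simp
  define c where "c = cinner x y / complex_of_real ((norm y)\<^sup>2)"
  define v where "v = x - c *\<^sub>C y"
  have "cinner v y = 0"
    using y by (simp add: v_def cinner_diff_left cinner_scaleC_left cinner_self c_def)
  then have "cinner v v = cinner v x"
    by (subst (2) v_def) (simp add: cinner_diff_right cinner_scaleC_right)
  also have "\<dots> = complex_of_real ((norm x)\<^sup>2) - c * cnj (cinner x y)"
    by (simp add: v_def cinner_diff_left cinner_scaleC_left cinner_self cinner_commute[of y x])
  also have "c * cnj (cinner x y) = complex_of_real ((cmod (cinner x y))\<^sup>2 / (norm y)\<^sup>2)"
    unfolding of_real_divide complex_norm_square[of "cinner x y"] by (simp add: c_def)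
  finally have "complex_of_real ((norm v)\<^sup>2) = complex_of_real ((norm x)\<^sup>2 - (cmod (cinner x y))\<^sup>2 / (norm y)\<^sup>2)"
    by (simp add: cinner_self)
  then have "(norm v)\<^sup>2 = (norm x)\<^sup>2 - (cmod (cinner x y))\<^sup>2 / (norm y)\<^sup>2"
    unfolding of_real_eq_iff .
  then have "(cmod (cinner x y))\<^sup>2 / (norm y)\<^sup>2 \<le> (norm x)\<^sup>2"
    using zero_le_power2[of "norm v"] by linarith
  then have "(cmod (cinner x y))\<^sup>2 \<le> (norm x * norm y)\<^sup>2"
    using y by (simp add: field_simps power_mult_distrib)
  then show ?thesis by (rule power2_le_imp_le) simp
qed simp

text \<open>Evaluates the definite description: the values of two adjoints at any point differ by a
  vector orthogonal to itself.\<close>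

lemma cadjoint_eq:
  assumes B: "B \<in> bounded_operators" "\<And>f g. cinner (A f) g = cinner f (B g)"
  shows "cadjoint A = B"
  unfolding cadjoint_def
proof (rule the_equality)
  show "B \<in> bounded_operators \<and> (\<forall>f g. cinner (A f) g = cinner f (B g))"
    using B by blast
  fix C assume C: "C \<in> bounded_operators \<and> (\<forall>f g. cinner (A f) g = cinner f (C g))"
  show "C = B"
  proof
    fix g
    have "cinner (C g - B g) (C g - B g) = 0"
      using B(2)[of "C g - B g" g] C by (simp add: cinner_diff_right)
    then have "norm (C g - B g) = 0" by (simp only: cinner_self of_real_eq_0_iff) simp
    then show "C g = B g" by simp
  qed
qed

text \<open>The form in \<open>hyponormal\<close> is the squared norm of \<open>A f\<close> minus
  that of \<open>B f\<close>, and the comparison of these norms is a closed condition on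
  \<open>f\<close>.\<close>

lemma hyponormalI_dense:
  assumes A: "A \<in> bounded_operators" and B: "B \<in> bounded_operators"
    and adj: "\<And>f g. cinner (A f) g = cinner f (B g)"
    and dense: "closure V = UNIV" and le: "\<And>f. f \<in> V \<Longrightarrow> norm (B f) \<le> norm (A f)"
  shows "hyponormal A"
proof -
  have "continuous_on UNIV A" "continuous_on UNIV B"
    using A B by (auto simp: bounded_operators_def intro: linear_continuous_on)
  then have "closed {f. norm (B f) \<le> norm (A f)}"
    by (intro closed_Collect_le continuous_on_norm)
  then have "closure V \<subseteq> {f. norm (B f) \<le> norm (A f)}"
    using le by (intro closure_minimal) auto
  then have le': "norm (B f) \<le> norm (A f)" for f
    using dense by auto
  have "cinner (B (A f) - A (B f)) f = complex_of_real ((norm (A f))\<^sup>2 - (norm (B f))\<^sup>2)" for f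
    by (simp add: cinner_diff_left adj[of "B f" f] cinner_commute[of "B (A f)" f] adj[of f "A f", symmetric] cinner_self)
  then show ?thesis
    unfolding hyponormal_def cadjoint_eq[OF B adj] using A le'
    by (simp add: complex_nonneg_Reals_iff power_mono)
qed

lemma dense_image:
  fixes L :: "'a::topological_space \<Rightarrow> 'b::topological_space"
  assumes "continuous_on UNIV L" "closure X = UNIV" "closure (range L) = UNIV"
  shows "closure (L ` X) = UNIV"
proof -
  have "range L \<subseteq> closure (L ` X)"
    using image_closure_subset[of X L "closure (L ` X)"] assms closure_subset
    by (metis closed_closure)
  then show ?thesis using assms(3) closure_minimal[OF _ closed_closure] by blast
qed

section \<open>Truncations and adjoints in \<open>ell2\<close>\<close>

lemma ell2_eqI: "(\<And>n. ell2_nth f n = ell2_nth g n) \<Longrightarrow> f = g"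
  by (auto simp: ell2_nth_inject[symmetric])

lift_definition ell2_unit :: "nat \<Rightarrow> ell2" is "\<lambda>k n. if n = k then 1 else 0"
  by (rule summable_finite[where N = "{k}" for k]) auto

lemma ell2_nth_sum: "ell2_nth (\<Sum>i\<in>I. f i) n = (\<Sum>i\<in>I. ell2_nth (f i) n)"
  by (induction I rule: infinite_finite_induct) (simp_all add: zero_ell2.rep_eq plus_ell2.rep_eq)

definition ell2_trunc :: "nat \<Rightarrow> ell2 \<Rightarrow> ell2" where
  "ell2_trunc N f = (\<Sum>j<N. ell2_nth f j *\<^sub>C ell2_unit j)"

lemma ell2_nth_trunc: "ell2_nth (ell2_trunc N f) n = (if n < N then ell2_nth f n else 0)"
  by (simp add: ell2_trunc_def ell2_nth_sum scaleC_ell2.rep_eq ell2_unit.rep_eq if_distrib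
      cong: if_cong)

lemma ell2_norm_square: "(norm f)\<^sup>2 = (\<Sum>n. (cmod (ell2_nth f n))\<^sup>2)"
  by (simp add: norm_ell2.rep_eq suminf_nonneg ell2_nth_summable)

lemma ell2_trunc_tendsto: "(\<lambda>N. ell2_trunc N f) \<longlonglongrightarrow> f"
proof -
  let ?s = "\<lambda>N. \<Sum>n<N. (cmod (ell2_nth f n))\<^sup>2"
  have bound: "norm (f - ell2_trunc N f) \<le> sqrt ((norm f)\<^sup>2 - ?s N)" for N
  proof (rule ell2_norm_le)
    show "0 \<le> sqrt ((norm f)\<^sup>2 - ?s N)" using ell2_partial_le[where N = N and f = f] by simp
    fix K
    \<comment> \<open>The longer range contains \<open>{..<N}\<close>, where the difference
      vanishes, so the sum becomes a difference of two partial sums.\<close>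
    have "(\<Sum>n<K. (cmod (ell2_nth (f - ell2_trunc N f) n))\<^sup>2)
        \<le> (\<Sum>n<N + K. (cmod (ell2_nth (f - ell2_trunc N f) n))\<^sup>2)"
      by (rule sum_mono2) auto
    also have "\<dots> = (\<Sum>n<N + K. (cmod (ell2_nth f n))\<^sup>2 - (if n < N then (cmod (ell2_nth f n))\<^sup>2 else 0))"
      by (intro sum.cong) (auto simp: minus_ell2.rep_eq ell2_nth_trunc)
    also have "\<dots> = ?s (N + K) - ?s N"
    proof -
      have "{..<N + K} \<inter> {n. n < N} = {..<N}" by auto
      then show ?thesis by (simp add: sum_subtractf sum.If_cases)
    qed
    also have "\<dots> \<le> (sqrt ((norm f)\<^sup>2 - ?s N))\<^sup>2"
      using ell2_partial_le[where N = "N + K" and f = f] ell2_partial_le[where N = N and f = f] by simp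
    finally show "(\<Sum>n<K. (cmod (ell2_nth (f - ell2_trunc N f) n))\<^sup>2) \<le> (sqrt ((norm f)\<^sup>2 - ?s N))\<^sup>2" .
  qed
  have "?s \<longlonglongrightarrow> (norm f)\<^sup>2"
    unfolding ell2_norm_square by (rule summable_LIMSEQ[OF ell2_nth_summable])
  then have "(\<lambda>N. sqrt ((norm f)\<^sup>2 - ?s N)) \<longlonglongrightarrow> sqrt ((norm f)\<^sup>2 - (norm f)\<^sup>2)"
    by (intro tendsto_intros)
  then have lim: "(\<lambda>N. sqrt ((norm f)\<^sup>2 - ?s N)) \<longlonglongrightarrow> 0" by simp
  have "(\<lambda>N. f - ell2_trunc N f) \<longlonglongrightarrow> 0"
    by (rule Lim_null_comparison[OF always_eventually lim]) (use bound in blast)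
  then have "(\<lambda>N. f - (f - ell2_trunc N f)) \<longlonglongrightarrow> f - 0" by (intro tendsto_intros)
  then show ?thesis by simp
qed

lemma bounded_operators_sum_units:
  assumes "A \<in> bounded_operators"
  shows "A (\<Sum>j\<in>J. c j *\<^sub>C ell2_unit j) = (\<Sum>j\<in>J. c j *\<^sub>C A (ell2_unit j))"
proof -
  interpret bounded_linear A using assms by (simp add: bounded_operators_def)
  show ?thesis using assms by (simp add: sum bounded_operators_def)
qed

text \<open>The coordinates of \<open>B f\<close> are forced by testing against unit vectors; the
  substance is their square-summability.\<close>

lemma ell2_adjoint:
  assumes A: "A \<in> bounded_operators"
  obtains B where "B \<in> bounded_operators" "\<And>f g. cinner (A f) g = cinner f (B g)"
    "\<And>f j. ell2_nth (B f) j = cinner f (A (ell2_unit j))"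
proof -
  interpret bounded_linear A using A by (simp add: bounded_operators_def)
  obtain K where K: "0 < K" "\<And>f. norm (A f) \<le> norm f * K" using pos_bounded by blast
  have partial: "(\<Sum>j<N. (cmod (cinner f (A (ell2_unit j))))\<^sup>2) \<le> (K * norm f)\<^sup>2" for f N
  proof -
    define c where "c j = cinner f (A (ell2_unit j))" for j
    \<comment> \<open>Testing against \<open>h\<close> gives \<open>cinner f (A h) = s\<close> with
      \<open>norm h \<le> sqrt s\<close>, so Cauchy-Schwarz bounds \<open>s\<close> by
      \<open>norm f * (sqrt s * K)\<close>.\<close>
    define h where "h = (\<Sum>j<N. c j *\<^sub>C ell2_unit j)"
    define s where "s = (\<Sum>j<N. (cmod (c j))\<^sup>2)"
    have s0: "0 \<le> s" by (simp add: s_def sum_nonneg)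
    have nth: "ell2_nth h n = (if n < N then c n else 0)" for n
      by (simp add: h_def ell2_nth_sum scaleC_ell2.rep_eq ell2_unit.rep_eq if_distrib cong: if_cong)
    have "norm h \<le> sqrt s"
    proof (rule ell2_norm_le)
      fix M
      have "(\<Sum>n<M. (cmod (ell2_nth h n))\<^sup>2) \<le> (\<Sum>n<N + M. (cmod (ell2_nth h n))\<^sup>2)"
        by (rule sum_mono2) auto
      also have "\<dots> = s" unfolding s_def
        by (rule sum.mono_neutral_cong_right) (auto simp: nth)
      finally show "(\<Sum>n<M. (cmod (ell2_nth h n))\<^sup>2) \<le> (sqrt s)\<^sup>2" using s0 by simp
    qed (use s0 in simp)
    have "cinner f (A h) = complex_of_real s"
      unfolding h_def bounded_operators_sum_units[OF A] cinner_sum_right cinner_scaleC_right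
      by (simp add: c_def[symmetric] s_def complex_norm_square[symmetric] mult.commute del: of_real_power)
    then have "s \<le> norm f * norm (A h)"
      using cinner_Cauchy_Schwarz[of f "A h"] s0 by simp
    also have "\<dots> \<le> norm f * (sqrt s * K)"
      using K(2)[of h] K(1) \<open>norm h \<le> sqrt s\<close>
      by (intro mult_left_mono) (auto intro: order_trans mult_right_mono)
    finally have "sqrt s * sqrt s \<le> (K * norm f) * sqrt s" using s0 by (simp add: mult_ac)
    then have "sqrt s \<le> K * norm f"
      using s0 K(1) by (cases "s = 0") (auto intro: mult_right_le_imp_le[of _ "sqrt s"] simp del: real_sqrt_mult_self)
    then have "(sqrt s)\<^sup>2 \<le> (K * norm f)\<^sup>2" using s0 by (intro power_mono) auto
    then show ?thesis using s0 by (simp add: s_def c_def)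
  qed
  define B where "B f = Abs_ell2 (\<lambda>j. cinner f (A (ell2_unit j)))" for f
  have nth: "ell2_nth (B f) j = cinner f (A (ell2_unit j))" for f j
    unfolding B_def using summableI_nonneg_bounded[OF _ partial[of f]]
    by (subst Abs_ell2_inverse) auto
  have scale: "B (c *\<^sub>C f) = c *\<^sub>C B f" for c f
    by (rule ell2_eqI) (simp add: nth scaleC_ell2.rep_eq cinner_scaleC_left)
  have "bounded_linear B"
  proof (rule bounded_linear_intro[where K = K])
    show "B (f + g) = B f + B g" for f g
      by (rule ell2_eqI) (simp add: nth plus_ell2.rep_eq cinner_add_left)
    show "B (r *\<^sub>R f) = r *\<^sub>R B f" for r f by (simp add: scaleR_scaleC scale)
    show "norm (B f) \<le> norm f * K" for f
      using ell2_norm_le[of "B f" "K * norm f"] partial[of f] K(1) by (simp add: nth mult.commute)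
  qed
  \<comment> \<open>On truncations of \<open>f\<close> the identity is linearity; both sides are
    then limits of the same sequence.\<close>
  moreover have "cinner (A f) g = cinner f (B g)" for f g
  proof (rule LIMSEQ_unique)
    have "(\<lambda>N. \<Sum>j<N. ell2_nth f j * cnj (ell2_nth (B g) j)) \<longlonglongrightarrow> cinner f (B g)"
      unfolding cinner_ell2.rep_eq
      by (intro summable_LIMSEQ square_summable_prod ell2_nth_summable)
    moreover have "(\<Sum>j<N. ell2_nth f j * cnj (ell2_nth (B g) j)) = cinner (A (ell2_trunc N f)) g" for N
    proof -
      have "cinner g (A (ell2_trunc N f)) = (\<Sum>j<N. cnj (ell2_nth f j) * ell2_nth (B g) j)"
        unfolding ell2_trunc_def bounded_operators_sum_units[OF A] cinner_sum_right cinner_scaleC_right nth ..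
      then show ?thesis by (subst cinner_commute) (simp add: mult.commute)
    qed
    ultimately show "(\<lambda>N. cinner (A (ell2_trunc N f)) g) \<longlonglongrightarrow> cinner f (B g)" by simp
    have "(\<lambda>N. A (ell2_trunc N f)) \<longlonglongrightarrow> A f"
      by (rule tendsto[OF ell2_trunc_tendsto])
    then have 0: "(\<lambda>N. norm (A (ell2_trunc N f) - A f) * norm g) \<longlonglongrightarrow> 0"
      by (intro tendsto_mult_left_zero) (simp add: tendsto_norm_zero_iff LIM_zero_iff)
    have "(\<lambda>N. cinner (A (ell2_trunc N f) - A f) g) \<longlonglongrightarrow> 0"
      by (rule Lim_null_comparison[OF _ 0]) (simp add: cinner_Cauchy_Schwarz)
    then show "(\<lambda>N. cinner (A (ell2_trunc N f)) g) \<longlonglongrightarrow> cinner (A f) g"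
      by (simp add: cinner_diff_left LIM_zero_iff)
  qed
  ultimately show thesis using that[of B] scale nth by (simp add: bounded_operators_def)
qed


section \<open>Third differences of finitely supported sequences\<close>

lift_definition ell2_shift :: "ell2 \<Rightarrow> ell2" is "\<lambda>f n. case n of 0 \<Rightarrow> 0 | Suc k \<Rightarrow> f k"
  by (subst summable_Suc_iff[symmetric]) simp

definition ell2_diff :: "ell2 \<Rightarrow> ell2" where
  "ell2_diff f = f - ell2_shift f"

text \<open>Stated for arbitrary sequences, because it is also applied to polynomial convolution
  kernels, which are not square-summable.\<close>

definition backward_diff :: "(nat \<Rightarrow> 'a) \<Rightarrow> nat \<Rightarrow> 'a::ab_group_add" where
  "backward_diff w n = w n - (case n of 0 \<Rightarrow> 0 | Suc k \<Rightarrow> w k)"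

lemma ell2_nth_diff: "ell2_nth (ell2_diff f) = backward_diff (ell2_nth f)"
  by (simp add: fun_eq_iff ell2_diff_def minus_ell2.rep_eq ell2_shift.rep_eq backward_diff_def)

lemma norm_ell2_shift: "norm (ell2_shift f) \<le> norm f"
proof (rule ell2_norm_le)
  fix N
  show "(\<Sum>n<N. (cmod (ell2_nth (ell2_shift f) n))\<^sup>2) \<le> (norm f)\<^sup>2"
  proof (cases N)
    case (Suc K)
    then show ?thesis using ell2_partial_le[where N = K and f = f]
      by (simp add: ell2_shift.rep_eq sum.lessThan_Suc_shift del: sum.lessThan_Suc)
  qed simp
qed simp

lemma bounded_linear_ell2_diff: "bounded_linear ell2_diff"
proof -
  have "bounded_linear ell2_shift"
  proof (rule bounded_linear_intro[where K = 1])
    show "ell2_shift (f + g) = ell2_shift f + ell2_shift g" for f g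
      by transfer (auto simp: fun_eq_iff split: nat.split)
    show "ell2_shift (r *\<^sub>R f) = r *\<^sub>R ell2_shift f" for r f
      by transfer (auto simp: fun_eq_iff split: nat.split)
  qed (simp add: norm_ell2_shift)
  then show ?thesis
    unfolding ell2_diff_def[abs_def] by (intro bounded_linear_sub bounded_linear_ident)
qed

lemma subspace_closure:
  fixes S :: "'a::real_normed_vector set"
  assumes "subspace S"
  shows "subspace (closure S)"
proof (rule subspaceI)
  show "0 \<in> closure S" using assms closure_subset subspace_0 by blast
  fix x y assume "x \<in> closure S" "y \<in> closure S"
  then obtain X Y where "\<And>n. X n \<in> S" "X \<longlonglongrightarrow> x" "\<And>n. Y n \<in> S" "Y \<longlonglongrightarrow> y"
    unfolding closure_sequential by blast
  then have "\<forall>n. X n + Y n \<in> S" "(\<lambda>n. X n + Y n) \<longlonglongrightarrow> x + y"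
    using assms by (auto intro: subspace_add tendsto_add)
  then show "x + y \<in> closure S"
    unfolding closure_sequential by (intro exI[of _ "\<lambda>n. X n + Y n"]) blast
next
  fix r x assume "x \<in> closure S"
  then obtain X where "\<And>n. X n \<in> S" "X \<longlonglongrightarrow> x"
    unfolding closure_sequential by blast
  then have "\<forall>n. r *\<^sub>R X n \<in> S" "(\<lambda>n. r *\<^sub>R X n) \<longlonglongrightarrow> r *\<^sub>R x"
    using assms by (auto intro: subspace_scale tendsto_scaleR)
  then show "r *\<^sub>R x \<in> closure S"
    unfolding closure_sequential by (intro exI[of _ "\<lambda>n. r *\<^sub>R X n"]) blast
qed

text \<open>Multiples of \<open>ell2_unit 0\<close> are limits of differences of ramps. Each
  difference \<open>(I - S) e\<^sub>k = e\<^sub>k - e\<^sub>k\<^sub>+\<^sub>1\<close> then leads to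
  the next unit vector, and truncations give every sequence.\<close>

lemma closure_range_ell2_diff: "closure (range ell2_diff) = UNIV"
proof -
  interpret bounded_linear ell2_diff by (rule bounded_linear_ell2_diff)
  let ?R = "closure (range ell2_diff)"
  \<comment> \<open>\<open>subspace\<close> is over the reals, so the memberships below carry an
    arbitrary complex factor \<open>c\<close>.\<close>
  have sub: "subspace ?R"
    by (intro subspace_closure linear_subspace_image subspace_UNIV linear_axioms)
  have zero: "c *\<^sub>C ell2_unit 0 \<in> ?R" for c
  proof -
    \<comment> \<open>The difference of a ramp of length \<open>m + 1\<close> misses the target by \<open>m + 1\<close> entries \<open>c / (m + 1)\<close>.\<close>
    define g where "g m = Abs_ell2 (\<lambda>k. c * complex_of_real (max 0 (1 - real k / real (Suc m))))" for m
    have nth_g: "ell2_nth (g m) k = c * complex_of_real (max 0 (1 - real k / real (Suc m)))" for m k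
      unfolding g_def
      by (subst Abs_ell2_inverse) (auto intro!: summable_finite[where N = "{..m}"] max_absorb1 simp: not_le field_simps)
    have nth: "ell2_nth (c *\<^sub>C ell2_unit 0 - ell2_diff (g m)) k
        = (if k \<in> {1..Suc m} then c / complex_of_real (real (Suc m)) else 0)" for m k
    proof (cases k)
      case 0
      then show ?thesis by (simp add: minus_ell2.rep_eq scaleC_ell2.rep_eq ell2_unit.rep_eq
          ell2_nth_diff backward_diff_def nth_g)
    next
      case (Suc i)
      have "max 0 (1 - real i / real (Suc m)) - max 0 (1 - real (Suc i) / real (Suc m))
          = (if i \<le> m then 1 / real (Suc m) else 0)"
      proof (cases "i \<le> m")
        case True
        then have "real i / real (Suc m) \<le> 1" "real (Suc i) / real (Suc m) \<le> 1" by simp_all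
        then show ?thesis using True by (simp add: max_def diff_divide_distrib[symmetric] del: of_nat_Suc)
      next
        case False
        then have "1 \<le> real i / real (Suc m)" "1 \<le> real (Suc i) / real (Suc m)" by simp_all
        then show ?thesis using False by (simp add: max_def del: of_nat_Suc)
      qed
      then have "c * complex_of_real (max 0 (1 - real i / real (Suc m)))
          - c * complex_of_real (max 0 (1 - real (Suc i) / real (Suc m)))
          = c * complex_of_real (if i \<le> m then 1 / real (Suc m) else 0)"
        by (simp only: right_diff_distrib[symmetric] of_real_diff[symmetric])
      then show ?thesis using Suc
        by (simp add: minus_ell2.rep_eq scaleC_ell2.rep_eq ell2_unit.rep_eq
          ell2_nth_diff backward_diff_def nth_g del: of_nat_Suc)
    qed
    have bound: "norm (c *\<^sub>C ell2_unit 0 - ell2_diff (g m)) \<le> cmod c / sqrt (real (Suc m))" for m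
    proof (rule ell2_norm_le)
      fix K
      let ?q = "(cmod c / real (Suc m))\<^sup>2"
      have "(\<Sum>k<K. (cmod (ell2_nth (c *\<^sub>C ell2_unit 0 - ell2_diff (g m)) k))\<^sup>2)
          = (\<Sum>k<K. if k \<in> {1..Suc m} then ?q else 0)"
        by (intro sum.cong refl) (auto simp: nth norm_divide simp del: of_nat_Suc)
      also have "\<dots> = real (card ({..<K} \<inter> {1..Suc m})) * ?q"
        unfolding sum.inter_restrict[OF finite_lessThan, symmetric] by simp
      also have "\<dots> \<le> real (card {1..Suc m}) * ?q"
        by (intro mult_right_mono of_nat_mono card_mono) auto
      also have "\<dots> = (cmod c / sqrt (real (Suc m)))\<^sup>2"
        by (simp add: power_divide power2_eq_square[of "real (Suc m)"] del: of_nat_Suc)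
      finally show "(\<Sum>k<K. (cmod (ell2_nth (c *\<^sub>C ell2_unit 0 - ell2_diff (g m)) k))\<^sup>2)
          \<le> (cmod c / sqrt (real (Suc m)))\<^sup>2" .
    qed simp
    have "(\<lambda>m. cmod c * sqrt (inverse (real (Suc m)))) \<longlonglongrightarrow> cmod c * sqrt 0"
      by (intro tendsto_intros LIMSEQ_inverse_real_of_nat)
    then have lim: "(\<lambda>m. cmod c / sqrt (real (Suc m))) \<longlonglongrightarrow> 0"
      by (simp add: real_sqrt_inverse divide_inverse)
    have "(\<lambda>m. c *\<^sub>C ell2_unit 0 - ell2_diff (g m)) \<longlonglongrightarrow> 0"
      by (rule Lim_null_comparison[OF always_eventually lim]) (use bound in blast)
    then have "(\<lambda>m. c *\<^sub>C ell2_unit 0 - (c *\<^sub>C ell2_unit 0 - ell2_diff (g m))) \<longlonglongrightarrow> c *\<^sub>C ell2_unit 0 - 0"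
      by (intro tendsto_intros)
    then have "(\<lambda>m. ell2_diff (g m)) \<longlonglongrightarrow> c *\<^sub>C ell2_unit 0" by simp
    then show ?thesis unfolding closure_sequential
      by (intro exI[of _ "\<lambda>m. ell2_diff (g m)"] conjI allI rangeI)
  qed
  have unit: "c *\<^sub>C ell2_unit k \<in> ?R" for c k
  proof (induction k)
    case (Suc k)
    have "c *\<^sub>C ell2_unit (Suc k) = c *\<^sub>C ell2_unit k - ell2_diff (c *\<^sub>C ell2_unit k)"
      by (rule ell2_eqI) (auto simp: minus_ell2.rep_eq scaleC_ell2.rep_eq ell2_unit.rep_eq
          ell2_nth_diff backward_diff_def split: nat.split)
    moreover have "ell2_diff (c *\<^sub>C ell2_unit k) \<in> ?R"
      by (rule subsetD[OF closure_subset rangeI])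
    ultimately show ?case using Suc subspace_diff[OF sub] by simp
  qed (rule zero)
  have "f \<in> ?R" for f
  proof (rule closed_sequentially[OF closed_closure _ ell2_trunc_tendsto])
    show "ell2_trunc N f \<in> ?R" for N
      unfolding ell2_trunc_def by (intro subspace_sum[OF sub] unit)
  qed
  then show ?thesis by blast
qed

definition ell2_finite :: "ell2 set" where
  "ell2_finite = {f. \<exists>N. \<forall>n\<ge>N. ell2_nth f n = 0}"

lemma closure_ell2_finite: "closure ell2_finite = UNIV"
proof -
  have "ell2_trunc N f \<in> ell2_finite" for N f
    by (auto simp: ell2_finite_def ell2_nth_trunc intro!: exI[of _ N])
  then have "f \<in> closure ell2_finite" for f
    unfolding closure_sequential
    by (intro exI[of _ "\<lambda>N. ell2_trunc N f"] conjI allI ell2_trunc_tendsto)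
  then show ?thesis by blast
qed

lemma closure_third_differences:
  "closure (ell2_diff ` ell2_diff ` ell2_diff ` ell2_finite) = UNIV"
proof -
  have "continuous_on UNIV ell2_diff"
    by (intro linear_continuous_on bounded_linear_ell2_diff)
  note dense = dense_image[OF this _ closure_range_ell2_diff]
  show ?thesis by (rule dense[OF dense[OF dense[OF closure_ell2_finite]]])
qed

section \<open>Moving differences across convolutions and pairings\<close>

lemma backward_diff_convolution:
  fixes p w :: "nat \<Rightarrow> 'a::comm_ring_1"
  shows "(\<Sum>j\<le>i. p (i - j) * backward_diff w j) = (\<Sum>j\<le>i. backward_diff p (i - j) * w j)"
proof (cases i)
  case (Suc n)
  have "(\<Sum>j\<le>i. p (i - j) * backward_diff w j)
      = (\<Sum>j\<le>Suc n. p (Suc n - j) * w j) - (\<Sum>j\<le>Suc n. p (Suc n - j) * (case j of 0 \<Rightarrow> 0 | Suc k \<Rightarrow> w k))"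
    unfolding Suc backward_diff_def by (simp only: right_diff_distrib sum_subtractf)
  also have "(\<Sum>j\<le>Suc n. p (Suc n - j) * (case j of 0 \<Rightarrow> 0 | Suc k \<Rightarrow> w k)) = (\<Sum>j\<le>n. p (n - j) * w j)"
    by (simp add: sum.atMost_Suc_shift del: sum.atMost_Suc)
  also have "(\<Sum>j\<le>Suc n. p (Suc n - j) * w j) - \<dots>
      = p 0 * w (Suc n) + (\<Sum>j\<le>n. (p (Suc n - j) - p (n - j)) * w j)"
    by (simp add: left_diff_distrib sum_subtractf)
  also have "(\<Sum>j\<le>n. (p (Suc n - j) - p (n - j)) * w j) = (\<Sum>j\<le>n. backward_diff p (Suc n - j) * w j)"
    by (intro sum.cong refl) (simp add: backward_diff_def Suc_diff_le)
  also have "p 0 * w (Suc n) + \<dots> = (\<Sum>j\<le>i. backward_diff p (i - j) * w j)"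
    by (simp add: Suc backward_diff_def)
  finally show ?thesis .
qed (simp add: backward_diff_def)

text \<open>The adjoint of \<open>I - S\<close> subtracts the next term. The left sum is one term
  longer because differencing lengthens the support by one; \<open>w N = 0\<close> removes the
  boundary term.\<close>

lemma backward_diff_summation_by_parts:
  fixes q w :: "nat \<Rightarrow> 'a::comm_ring_1"
  assumes "w N = 0"
  shows "(\<Sum>i<Suc N. backward_diff w i * q i) = (\<Sum>i<N. w i * (q i - q (Suc i)))"
proof -
  have "(\<Sum>i<Suc N. backward_diff w i * q i)
      = (\<Sum>i<Suc N. w i * q i) - (\<Sum>i<Suc N. (case i of 0 \<Rightarrow> 0 | Suc k \<Rightarrow> w k) * q i)"
    unfolding backward_diff_def by (simp only: left_diff_distrib sum_subtractf)
  also have "(\<Sum>i<Suc N. (case i of 0 \<Rightarrow> 0 | Suc k \<Rightarrow> w k) * q i) = (\<Sum>i<N. w i * q (Suc i))"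
    by (simp add: sum.lessThan_Suc_shift del: sum.lessThan_Suc)
  finally show ?thesis by (simp add: assms right_diff_distrib sum_subtractf)
qed

lemma cesaro3_pairing_weight: "cesaro3 \<alpha> i j = 6 * pairing_weight \<alpha> j i"
proof -
  have "real i + 1 + \<alpha> = real i + \<alpha> + 1" "real i + 2 + \<alpha> = real i + \<alpha> + 2" "real i + 3 + \<alpha> = real i + \<alpha> + 3"
    "real i + 1 - real j = real i - real j + 1" "real i + 2 - real j = real i - real j + 2" by simp_all
  moreover have "3 * x * y / D = 6 * (1 / D * (x * y / 2))" for x y D :: real
    by simp
  ultimately show ?thesis
    unfolding cesaro3_def pairing_weight_def cesaro_weight_def by (cases "j \<le> i") (simp_all only: if_True if_False mult_zero_right)
qed

text \<open>\<open>T\<close> is convolution with the coefficients \<open>p\<close> of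
  \<open>(1 - x)^(-3)\<close>. Moving the three differences from \<open>u\<close> onto
  \<open>p\<close> turns it into \<open>n + 1\<close>, then 1, then the unit impulse.\<close>

lemma cesaro3_operator_third_difference:
  assumes "0 \<le> \<alpha>"
  shows "ell2_nth (cesaro3_operator \<alpha> (ell2_diff (ell2_diff (ell2_diff u)))) i
    = complex_of_real (6 * cesaro_weight (real i + \<alpha>)) * ell2_nth u i"
proof -
  define p :: "nat \<Rightarrow> complex" where "p n = (of_nat n + 1) * (of_nat n + 2) / 2" for n
  have p1: "backward_diff p = (\<lambda>n. of_nat n + 1)"
    by (auto simp: fun_eq_iff backward_diff_def p_def field_simps split: nat.split)
  have p2: "backward_diff (\<lambda>n. of_nat n + 1 :: complex) = (\<lambda>_. 1)"
    by (auto simp: fun_eq_iff backward_diff_def split: nat.split)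
  have p3: "backward_diff (\<lambda>_. 1 :: complex) = (\<lambda>n. if n = 0 then 1 else 0)"
    by (auto simp: fun_eq_iff backward_diff_def split: nat.split)
  have "complex_of_real (cesaro3 \<alpha> i j) = complex_of_real (6 * cesaro_weight (real i + \<alpha>)) * p (i - j)"
    if "j \<le> i" for j
  proof -
    have "cesaro3 \<alpha> i j = 6 * cesaro_weight (real i + \<alpha>) * ((real (i - j) + 1) * (real (i - j) + 2) / 2)"
      using that by (simp add: cesaro3_pairing_weight pairing_weight_def of_nat_diff)
    then show ?thesis by (simp add: p_def)
  qed
  then have "ell2_nth (cesaro3_operator \<alpha> (ell2_diff (ell2_diff (ell2_diff u)))) i
      = complex_of_real (6 * cesaro_weight (real i + \<alpha>))
        * (\<Sum>j\<le>i. p (i - j) * ell2_nth (ell2_diff (ell2_diff (ell2_diff u))) j)"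
    by (simp add: ell2_nth_cesaro3[OF assms] sum_distrib_left mult.assoc)
  also have "(\<Sum>j\<le>i. p (i - j) * ell2_nth (ell2_diff (ell2_diff (ell2_diff u))) j)
      = (\<Sum>j\<le>i. (if i - j = 0 then 1 else 0) * ell2_nth u j)"
    using backward_diff_convolution[where p = p and i = i]
      backward_diff_convolution[where p = "\<lambda>n. of_nat n + 1 :: complex" and i = i]
      backward_diff_convolution[where p = "\<lambda>_. 1 :: complex" and i = i]
    unfolding ell2_nth_diff p1 p2 p3 by (simp only:)
  also have "\<dots> = (\<Sum>j\<le>i. if j = i then ell2_nth u j else 0)"
    by (intro sum.cong) auto
  finally show ?thesis by simp
qed

text \<open>This is coordinate \<open>j\<close> of \<open>M\<^sup>* f\<close> for
  \<open>f = (I - S)\<^sup>3 u\<close>: three summations by parts move the differences onto column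
  \<open>j\<close>.\<close>

lemma cesaro3_column_pairing:
  assumes "0 \<le> \<alpha>" and N: "\<And>n. N \<le> n \<Longrightarrow> ell2_nth u n = 0"
  shows "cinner (ell2_diff (ell2_diff (ell2_diff u))) (cesaro3_operator \<alpha> (ell2_unit j))
    = 6 * (\<Sum>n<N. ell2_nth u n * complex_of_real (pairing_kernel \<alpha> j n))"
proof -
  define q where "q i = complex_of_real (pairing_weight \<alpha> j i)" for i
  define U where "U = ell2_nth u"
  have U: "U n = 0" if "N \<le> n" for n using N that by (simp add: U_def)
  \<comment> \<open>These zeros make the series finite and remove the boundary terms of the
    summations by parts.\<close>
  have U1: "backward_diff U n = 0" if "Suc N \<le> n" for n
    using that by (auto simp: backward_diff_def U split: nat.split)
  have U2: "backward_diff (backward_diff U) n = 0" if "Suc (Suc N) \<le> n" for n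
    using that by (auto simp: backward_diff_def[of "backward_diff U"] U1 split: nat.split)
  have U3: "backward_diff (backward_diff (backward_diff U)) n = 0" if "Suc (Suc (Suc N)) \<le> n" for n
    using that by (auto simp: backward_diff_def[of "backward_diff (backward_diff U)"] U2 split: nat.split)
  have column: "ell2_nth (cesaro3_operator \<alpha> (ell2_unit j)) i = 6 * q i" for i
  proof -
    have "ell2_nth (cesaro3_operator \<alpha> (ell2_unit j)) i
        = (\<Sum>k\<le>i. if k = j then complex_of_real (cesaro3 \<alpha> i j) else 0)"
      unfolding ell2_nth_cesaro3[OF assms(1)] by (intro sum.cong) (auto simp: ell2_unit.rep_eq)
    also have "\<dots> = complex_of_real (cesaro3 \<alpha> i j)"
      by (auto simp: cesaro3_def)
    finally show ?thesis by (simp add: cesaro3_pairing_weight q_def)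
  qed
  have "cinner (ell2_diff (ell2_diff (ell2_diff u))) (cesaro3_operator \<alpha> (ell2_unit j))
      = (\<Sum>i. 6 * (backward_diff (backward_diff (backward_diff U)) i * q i))"
    by (simp add: cinner_ell2.rep_eq ell2_nth_diff column U_def[symmetric] q_def mult_ac)
  also have "\<dots> = (\<Sum>i<Suc (Suc (Suc N)). 6 * (backward_diff (backward_diff (backward_diff U)) i * q i))"
    by (rule suminf_finite) (auto simp: U3 simp del: lessThan_Suc)
  also have "\<dots> = 6 * (\<Sum>n<N. U n * (q n - q (Suc n) - (q (Suc n) - q (Suc (Suc n)))
      - (q (Suc n) - q (Suc (Suc n)) - (q (Suc (Suc n)) - q (Suc (Suc (Suc n)))))))"
    unfolding sum_distrib_left[symmetric]
      backward_diff_summation_by_parts[of "backward_diff (backward_diff U)", OF U2[OF order_refl]]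
      backward_diff_summation_by_parts[of "backward_diff U", OF U1[OF order_refl]]
      backward_diff_summation_by_parts[of U, OF U[OF order_refl]] ..
  also have "\<dots> = 6 * (\<Sum>n<N. U n * complex_of_real (pairing_kernel \<alpha> j n))"
    by (simp add: pairing_kernel_def q_def numeral_2_eq_2 numeral_3_eq_3 algebra_simps)
  finally show ?thesis by (simp add: U_def)
qed

theorem corollary2p4:
  fixes \<alpha> :: real
  assumes "\<alpha> \<in> {0, 1} \<union> {2..}"
  shows "hyponormal (cesaro3_operator \<alpha>)"
proof -
  have \<alpha>: "0 \<le> \<alpha>" using assms by auto
  note M = cesaro3_bounded[OF \<alpha>]
  obtain B where B: "B \<in> bounded_operators"
    "\<And>f g. cinner (cesaro3_operator \<alpha> f) g = cinner f (B g)"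
    "\<And>f j. ell2_nth (B f) j = cinner f (cesaro3_operator \<alpha> (ell2_unit j))"
    using ell2_adjoint[OF M] by blast
  show ?thesis
  proof (rule hyponormalI_dense[OF M B(1,2) closure_third_differences])
    fix f assume "f \<in> ell2_diff ` ell2_diff ` ell2_diff ` ell2_finite"
    then obtain u N where f: "f = ell2_diff (ell2_diff (ell2_diff u))"
      and N: "\<And>n. N \<le> n \<Longrightarrow> ell2_nth u n = 0"
      by (auto simp: ell2_finite_def)
    let ?U = "ell2_nth u"
    show "norm (B f) \<le> norm (cesaro3_operator \<alpha> f)"
    proof (rule ell2_norm_le)
      fix K
      \<comment> \<open>\<open>N' \<ge> N\<close> keeps \<open>u\<close> supported below
        \<open>N'\<close>, and \<open>N' \<ge> K\<close> makes \<open>N' + 3\<close> cover all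
        coordinates being summed.\<close>
      define N' where "N' = max N K"
      have Bf: "ell2_nth (B f) j = 6 * (\<Sum>n<N'. ?U n * complex_of_real (pairing_kernel \<alpha> j n))" for j
        unfolding B(3) f by (rule cesaro3_column_pairing[OF \<alpha>]) (simp add: N N'_def)
      \<comment> \<open>Kernel and weights are real, so real and imaginary parts of \<open>u\<close>
        separate and the contraction applies to each.\<close>
      have Bf2: "(cmod (ell2_nth (B f) j))\<^sup>2 = 36 * ((\<Sum>n<N'. Re (?U n) * pairing_kernel \<alpha> j n)\<^sup>2
          + (\<Sum>n<N'. Im (?U n) * pairing_kernel \<alpha> j n)\<^sup>2)" for j
        unfolding Bf norm_mult power_mult_distrib by (simp add: cmod_power2)
      have Mf2: "(cmod (ell2_nth (cesaro3_operator \<alpha> f) n))\<^sup>2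
          = 36 * ((cesaro_weight (real n + \<alpha>) * Re (?U n))\<^sup>2 + (cesaro_weight (real n + \<alpha>) * Im (?U n))\<^sup>2)" for n
        unfolding f cesaro3_operator_third_difference[OF \<alpha>] norm_mult power_mult_distrib
        by (simp add: cmod_power2 algebra_simps)
      have "(\<Sum>j<K. (cmod (ell2_nth (B f) j))\<^sup>2) \<le> (\<Sum>j<N' + 3. (cmod (ell2_nth (B f) j))\<^sup>2)"
        by (rule sum_mono2) (auto simp: N'_def)
      also have "\<dots> \<le> (\<Sum>n<N'. (cmod (ell2_nth (cesaro3_operator \<alpha> f) n))\<^sup>2)"
        unfolding Bf2 Mf2 sum_distrib_left[symmetric] sum.distrib
        by (intro mult_left_mono add_mono pairing_kernel_contraction assms) simp
      also have "\<dots> \<le> (norm (cesaro3_operator \<alpha> f))\<^sup>2"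
        by (rule ell2_partial_le)
      finally show "(\<Sum>j<K. (cmod (ell2_nth (B f) j))\<^sup>2) \<le> (norm (cesaro3_operator \<alpha> f))\<^sup>2" .
    qed simp
  qed
qed

end
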